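(* Let $\mathbf G$ be a finite abelian group with $N=|\mathbf G|$, let $n\geqslant 4$ be an integer, and let $A\subseteq \mathbf G$ be a set with $|A|=\delta N$, $\delta>0$, such that the equation $$\alpha_1x_1+\dots+\alpha_nx_n=\beta,\qquad x_j\in A\ (j\in[n]),$$ has no solutions, where $\beta\in\mathbf G$ and $\alpha_1,\dots,\alpha_n$ are integers coprime to $|\mathbf G|$. Let $\varepsilon\in(0,1/8]$. Then there is a positive integer $l\leqslant (3\log(1/\delta))^{\frac{1}{[n/2]-1}}+1$ such that $$\|f_A\|_{\mathsf E_l}^{2l}\geqslant \varepsilon^{2l}\delta^{2l}N^{l+1}.$$
   Context: $[n/2]$ is the integer part of $n/2$, $[n]=\{1,\dots,n\}$, and $\log$ is the natural logarithm. The balanced function of $A$ is $f_A(x)=1_A(x)-\delta$. For $f,g:\mathbf G\to\mathbb R$, $(f\circ g)(x)=\sum_{y\in\mathbf G}f(y)g(y+x)$, and $\|f\|_{\mathsf E_l}^{2l}=\sum_{x\in\mathbf G}(f\circ f)^l(x)$. *)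

theory Defs
  imports Complex_Main "HOL-Library.Indicator_Function" "HOL-Algebra.Coset" "HOL-Algebra.Ring"
begin

text \<open>
  Groups are written additively: an \<open>abelian_group\<close> is the additive part of a
  \<open>ring_scheme\<close> record, whose multiplicative fields are unconstrained and play no role.
\<close>

definition balanced_fun :: "('a, 'm) ring_scheme \<Rightarrow> 'a set \<Rightarrow> 'a \<Rightarrow> real" where
  "balanced_fun G A x = indicat_real A x - real (card A) / real (order G)"

definition group_corr ::
  "('a, 'm) ring_scheme \<Rightarrow> ('a \<Rightarrow> real) \<Rightarrow> ('a \<Rightarrow> real) \<Rightarrow> 'a \<Rightarrow> real" where
  "group_corr G f g x = (\<Sum>y\<in>carrier G. f y * g (y \<oplus>\<^bsub>G\<^esub> x))"

text \<open>
  The quantity \<open>\<parallel>f\<parallel>\<^sub>E\<^sub>l\<close> raised to the power \<open>2l\<close>; it is this power, not its root, that is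
  given by a formula.
\<close>
definition E_norm_pow :: "('a, 'm) ring_scheme \<Rightarrow> nat \<Rightarrow> ('a \<Rightarrow> real) \<Rightarrow> real" where
  "E_norm_pow G l f = (\<Sum>x\<in>carrier G. group_corr G f f x ^ l)"

end

theory Submission
  imports Defs "HOL-Algebra.AbelCoset" "HOL-Algebra.Multiplicative_Group"
begin

text \<open>
  The exponent \<open>l = 2\<close> always works. Write \<open>A\<^sub>j = \<alpha>\<^sub>j A\<close>, a dilate of \<open>A\<close>
  by an automorphism, with balanced function \<open>f\<^sub>j\<close>. If \<open>\<delta> > 1/2\<close>, then \<open>A\<^sub>1 + A\<^sub>2\<close> is everything, so
  \<open>\<delta> \<le> 1/2\<close>, which makes the bound on \<open>l\<close> at least \<open>2\<close>.
  If \<open>E\<^sub>2(f\<^sub>A)\<close> were small, then so would be the \<open>L\<^sup>2\<close> norm of \<open>f\<^sub>1 * f\<^sub>2\<close>; as this convolution equals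
  \<open>-\<delta>\<^sup>2N\<close> off \<open>A\<^sub>1 + A\<^sub>2\<close>, the sumset would contain more than half of the group. The same
  holds for \<open>A\<^sub>3 + A\<^sub>4\<close>, and two sets that large represent every element as a sum.
\<close>

lemma sum_indicat_real_subset:
  assumes "finite C" and "A \<subseteq> C"
  shows "(\<Sum>x\<in>C. indicat_real A x) = real (card A)"
  using assms by (simp add: indicator_def sum_of_bool_eq Int_absorb1)

section \<open>Translations, reflections and pigeonhole in a finite abelian group\<close>

context abelian_group
begin

lemma bij_betw_add_right:
  assumes "a \<in> carrier G"
  shows "bij_betw (\<lambda>x. x \<oplus> a) (carrier G) (carrier G)"
  by (rule bij_betwI[where g = "\<lambda>x. x \<ominus> a"])
    (use assms in \<open>auto simp: minus_eq a_assoc l_neg r_neg\<close>)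

lemma bij_betw_minus_left:
  assumes "a \<in> carrier G"
  shows "bij_betw (\<lambda>x. a \<ominus> x) (carrier G) (carrier G)"
proof -
  have "a \<ominus> (a \<ominus> x) = x" if "x \<in> carrier G" for x
    using assms that by (simp add: minus_eq minus_add a_assoc[symmetric] r_neg)
  then show ?thesis
    by (intro bij_betwI[where g = "\<lambda>x. a \<ominus> x"]) (use assms in auto)
qed

text \<open>Pigeonhole: \<open>X\<close> and the reflection of \<open>Y\<close> in \<open>b\<close>
  are together too large to be disjoint, and a common point \<open>b \<ominus> y\<close> gives the
  representation.\<close>

lemma add_represents_if_card_gt:
  assumes fin: "finite (carrier G)" and X: "X \<subseteq> carrier G" and Y: "Y \<subseteq> carrier G"
    and card: "card X + card Y > order G" and b: "b \<in> carrier G"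
  obtains x y where "x \<in> X" "y \<in> Y" "x \<oplus> y = b"
proof -
  let ?Z = "(\<lambda>y. b \<ominus> y) ` Y"
  have inj: "inj_on (\<lambda>y. b \<ominus> y) Y"
    using bij_betw_minus_left[OF b] Y by (meson bij_betw_imp_inj_on inj_on_subset)
  have Z: "?Z \<subseteq> carrier G"
    using Y b by auto
  have finXY: "finite X" "finite Y"
    using X Y fin finite_subset by auto
  have "X \<inter> ?Z \<noteq> {}"
  proof
    assume "X \<inter> ?Z = {}"
    then have "card (X \<union> ?Z) = card X + card Y"
      using finXY by (simp add: card_Un_disjoint card_image[OF inj])
    moreover have "card (X \<union> ?Z) \<le> card (carrier G)"
      by (intro card_mono fin) (use X Z in auto)
    ultimately show False
      using card by (simp add: order_def)
  qed
  then obtain y where y: "y \<in> Y" "b \<ominus> y \<in> X"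
    by auto
  moreover have "(b \<ominus> y) \<oplus> y = b"
    using y Y b by (auto simp: minus_eq a_assoc l_neg subset_iff)
  ultimately show ?thesis
    using that by blast
qed

section \<open>Convolutions of balanced functions and their energy\<close>

lemma sum_balanced_fun:
  assumes "finite (carrier G)" and "A \<subseteq> carrier G"
  shows "(\<Sum>x\<in>carrier G. balanced_fun G A x) = 0"
proof -
  have "card (carrier G) > 0"
    using assms(1) by (auto simp: card_gt_0_iff)
  then show ?thesis
    by (simp add: balanced_fun_def sum_subtractf order_def sum_indicat_real_subset[OF assms])
qed

text \<open>A substitute for Parseval that avoids characters: expand the square, write the second
  summation variable as \<open>y \<oplus> t\<close>, and sum over \<open>x\<close> first. By
  translation invariance the inner sum depends only on \<open>t\<close>.\<close>

lemma sum_convolution_squared: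
  fixes f g :: "'a \<Rightarrow> real"
  assumes fin: "finite (carrier G)"
  shows "(\<Sum>x\<in>carrier G. (\<Sum>y\<in>carrier G. f y * g (x \<ominus> y))\<^sup>2)
       = (\<Sum>t\<in>carrier G. group_corr G f f t * group_corr G g g t)"
proof -
  let ?C = "carrier G"
  have shift: "(\<Sum>x\<in>?C. g (x \<ominus> y) * g (x \<ominus> (y \<oplus> t))) = group_corr G g g t"
    if y: "y \<in> ?C" and t: "t \<in> ?C" for y t
  proof -
    have "group_corr G g g t = (\<Sum>x\<in>?C. g x * g (x \<oplus> t))"
      by (simp add: group_corr_def)
    also have "\<dots> = (\<Sum>x\<in>?C. g (x \<oplus> \<ominus> (y \<oplus> t)) * g (x \<oplus> \<ominus> (y \<oplus> t) \<oplus> t))"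
      by (rule sum.reindex_bij_betw[OF bij_betw_add_right, symmetric]) (use y t in simp)
    also have "\<dots> = (\<Sum>x\<in>?C. g (x \<ominus> y) * g (x \<ominus> (y \<oplus> t)))"
    proof (rule sum.cong[OF refl])
      fix x assume x: "x \<in> ?C"
      have "x \<oplus> \<ominus> (y \<oplus> t) \<oplus> t = x \<ominus> y"
        using x y t by (simp add: minus_eq minus_add a_assoc l_neg)
      then show "g (x \<oplus> \<ominus> (y \<oplus> t)) * g (x \<oplus> \<ominus> (y \<oplus> t) \<oplus> t)
          = g (x \<ominus> y) * g (x \<ominus> (y \<oplus> t))"
        by (simp add: minus_eq)
    qed
    finally show ?thesis ..
  qed
  have "(\<Sum>x\<in>?C. (\<Sum>y\<in>?C. f y * g (x \<ominus> y))\<^sup>2)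
      = (\<Sum>x\<in>?C. \<Sum>y\<in>?C. \<Sum>z\<in>?C. f y * g (x \<ominus> y) * (f z * g (x \<ominus> z)))"
    by (simp add: power2_eq_square sum_product)
  also have "\<dots> = (\<Sum>x\<in>?C. \<Sum>y\<in>?C. \<Sum>t\<in>?C. f y * g (x \<ominus> y) * (f (y \<oplus> t) * g (x \<ominus> (y \<oplus> t))))"
  proof (rule sum.cong[OF refl], rule sum.cong[OF refl])
    fix x y assume "x \<in> ?C" and y: "y \<in> ?C"
    have "bij_betw (\<lambda>t. y \<oplus> t) ?C ?C"
      using bij_betw_add_right[OF y] y by (simp add: a_comm cong: bij_betw_cong)
    then show "(\<Sum>z\<in>?C. f y * g (x \<ominus> y) * (f z * g (x \<ominus> z)))
        = (\<Sum>t\<in>?C. f y * g (x \<ominus> y) * (f (y \<oplus> t) * g (x \<ominus> (y \<oplus> t))))"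
      by (rule sum.reindex_bij_betw[symmetric])
  qed
  \<comment> \<open>Reversing the order of summation puts \<open>x\<close> innermost, where
    \<open>shift\<close> evaluates the two factors of \<open>g\<close>.\<close>
  also have "\<dots> = (\<Sum>t\<in>?C. \<Sum>y\<in>?C. \<Sum>x\<in>?C.
      f y * f (y \<oplus> t) * (g (x \<ominus> y) * g (x \<ominus> (y \<oplus> t))))"
    by (subst sum.swap, subst sum.swap, subst (2) sum.swap) (simp add: mult_ac)
  also have "\<dots> = (\<Sum>t\<in>?C. \<Sum>y\<in>?C. f y * f (y \<oplus> t) * group_corr G g g t)"
    by (intro sum.cong refl) (simp add: shift flip: sum_distrib_left)
  also have "\<dots> = (\<Sum>t\<in>?C. group_corr G f f t * group_corr G g g t)"
    by (simp add: group_corr_def sum_distrib_right)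
  finally show ?thesis .
qed

text \<open>Outside the sumset no \<open>y\<close> has \<open>y \<in> A\<close> and
  \<open>x \<ominus> y \<in> B\<close>, so the product of indicators vanishes. The constant part of
  the first factor contributes nothing, because the second factor has sum zero; only
  \<open>A\<close> weighted by minus the density of \<open>B\<close> remains.\<close>

lemma convolution_balanced_fun_off_sumset:
  assumes fin: "finite (carrier G)" and A: "A \<subseteq> carrier G" and B: "B \<subseteq> carrier G"
    and x: "x \<in> carrier G" "x \<notin> A <+>\<^bsub>G\<^esub> B"
  shows "(\<Sum>y\<in>carrier G. balanced_fun G A y * balanced_fun G B (x \<ominus> y))
       = - (real (card A) * real (card B) / real (order G))"
proof -
  let ?C = "carrier G" and ?b = "real (card B) / real (order G)"
  have off: "indicat_real A y * indicat_real B (x \<ominus> y) = 0" if y: "y \<in> ?C" for y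
  proof -
    have "x = y \<oplus> (x \<ominus> y)"
      using x y by (simp add: minus_eq a_lcomm r_neg)
    then have "\<not> (y \<in> A \<and> x \<ominus> y \<in> B)"
      using x(2) unfolding set_add_def' by blast
    then show ?thesis
      by (auto simp: indicator_def)
  qed
  have zero: "(\<Sum>y\<in>?C. balanced_fun G B (x \<ominus> y)) = 0"
    using sum.reindex_bij_betw[OF bij_betw_minus_left[OF x(1)], of "balanced_fun G B"]
      sum_balanced_fun[OF fin B] by simp
  have "(\<Sum>y\<in>?C. balanced_fun G A y * balanced_fun G B (x \<ominus> y))
      = (\<Sum>y\<in>?C. indicat_real A y * balanced_fun G B (x \<ominus> y))
        - real (card A) / real (order G) * (\<Sum>y\<in>?C. balanced_fun G B (x \<ominus> y))"
    by (simp add: balanced_fun_def[of G A] left_diff_distrib sum_subtractf sum_distrib_left)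
  also have "\<dots> = (\<Sum>y\<in>?C. - ?b * indicat_real A y)"
    unfolding zero
    by (simp, intro sum.cong refl)
      (simp add: balanced_fun_def right_diff_distrib off mult.commute)
  also have "\<dots> = - ?b * (\<Sum>y\<in>?C. indicat_real A y)"
    by (simp only: sum_distrib_left)
  also have "(\<Sum>y\<in>?C. indicat_real A y) = real (card A)"
    by (rule sum_indicat_real_subset[OF fin A])
  finally show ?thesis
    by simp
qed

text \<open>A second-moment bound: the convolution is a known constant on the complement, so its
  total square mass limits the size of that complement. The mixed correlation sum is then split into
  the two energies by 2ab \<le> a^2 + b^2.\<close>

lemma card_compl_sumset_le:
  assumes fin: "finite (carrier G)" and A: "A \<subseteq> carrier G" and B: "B \<subseteq> carrier G"
  shows "real (card (carrier G - (A <+>\<^bsub>G\<^esub> B))) * (real (card A) * real (card B) / real (order G))\<^sup>2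
       \<le> (E_norm_pow G 2 (balanced_fun G A) + E_norm_pow G 2 (balanced_fun G B)) / 2"
proof -
  let ?C = "carrier G" and ?f = "balanced_fun G A" and ?g = "balanced_fun G B"
  let ?M = "?C - (A <+>\<^bsub>G\<^esub> B)"
  have "real (card ?M) * (real (card A) * real (card B) / real (order G))\<^sup>2
      = (\<Sum>x\<in>?M. (\<Sum>y\<in>?C. ?f y * ?g (x \<ominus> y))\<^sup>2)"
    by (simp add: convolution_balanced_fun_off_sumset[OF fin A B])
  also have "\<dots> \<le> (\<Sum>x\<in>?C. (\<Sum>y\<in>?C. ?f y * ?g (x \<ominus> y))\<^sup>2)"
    by (rule sum_mono2[OF fin]) auto
  also have "\<dots> = (\<Sum>t\<in>?C. group_corr G ?f ?f t * group_corr G ?g ?g t)"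
    by (rule sum_convolution_squared[OF fin])
  also have "\<dots> \<le> (\<Sum>t\<in>?C. ((group_corr G ?f ?f t)\<^sup>2 + (group_corr G ?g ?g t)\<^sup>2) / 2)"
  proof (rule sum_mono)
    fix t
    show "group_corr G ?f ?f t * group_corr G ?g ?g t
        \<le> ((group_corr G ?f ?f t)\<^sup>2 + (group_corr G ?g ?g t)\<^sup>2) / 2"
      using sum_squares_bound[of "group_corr G ?f ?f t" "group_corr G ?g ?g t"] by simp
  qed
  also have "\<dots> = (E_norm_pow G 2 ?f + E_norm_pow G 2 ?g) / 2"
    by (simp add: E_norm_pow_def sum.distrib flip: sum_divide_distrib)
  finally show ?thesis .
qed

section \<open>Invariance of the energy under automorphisms, and dilations as automorphisms\<close>

lemma E_norm_pow_image:
  assumes bij: "bij_betw h (carrier G) (carrier G)"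
    and add: "\<And>x y. x \<in> carrier G \<Longrightarrow> y \<in> carrier G \<Longrightarrow> h (x \<oplus> y) = h x \<oplus> h y"
    and A: "A \<subseteq> carrier G"
  shows "E_norm_pow G l (balanced_fun G (h ` A)) = E_norm_pow G l (balanced_fun G A)"
proof -
  let ?C = "carrier G" and ?f = "balanced_fun G A" and ?g = "balanced_fun G (h ` A)"
  have inj: "inj_on h ?C"
    using bij by (rule bij_betw_imp_inj_on)
  \<comment> \<open>Injectivity of \<open>h\<close> preserves both membership and cardinality, so
    the two balanced functions agree up to transport along \<open>h\<close>; additivity then carries
    this over to correlations.\<close>
  have fg: "?g (h x) = ?f x" if "x \<in> ?C" for x
    using that inj_on_image_mem_iff[OF inj that A] card_image[OF inj_on_subset[OF inj A]]
    by (simp add: balanced_fun_def indicator_def)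
  have corr: "group_corr G ?g ?g (h x) = group_corr G ?f ?f x" if x: "x \<in> ?C" for x
  proof -
    have "group_corr G ?g ?g (h x) = (\<Sum>y\<in>?C. ?g (h y) * ?g (h y \<oplus> h x))"
      unfolding group_corr_def by (rule sum.reindex_bij_betw[OF bij, symmetric])
    also have "\<dots> = group_corr G ?f ?f x"
      unfolding group_corr_def
      by (intro sum.cong refl) (simp add: x fg flip: add)
    finally show ?thesis .
  qed
  have "E_norm_pow G l ?g = (\<Sum>x\<in>?C. group_corr G ?g ?g (h x) ^ l)"
    unfolding E_norm_pow_def by (rule sum.reindex_bij_betw[OF bij, symmetric])
  then show ?thesis
    by (simp add: E_norm_pow_def corr)
qed

text \<open>With a Bezout relation \<open>k * u + order G * v = 1\<close>, dilation by
  \<open>u\<close> inverts dilation by \<open>k\<close>, since the group order annihilates every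
  element.\<close>

lemma bij_betw_dilation:
  fixes k :: int
  assumes fin: "finite (carrier G)" and k: "coprime k (int (order G))"
  shows "bij_betw (\<lambda>x. [k] \<cdot>\<^bsub>G\<^esub> x) (carrier G) (carrier G)"
proof -
  obtain u v where uv: "k * u + int (order G) * v = 1"
    using k by (metis bezout_int coprime_imp_gcd_eq_1 mult.commute)
  have inv: "[(k * u)] \<cdot>\<^bsub>G\<^esub> x = x" if x: "x \<in> carrier G" for x
  proof -
    have ord: "[int (order G)] \<cdot>\<^bsub>G\<^esub> x = \<zero>"
      using add.pow_order_eq_1[OF x] by (simp add: add_pow_def int_pow_int order_def)
    have "x = [(k * u + int (order G) * v)] \<cdot>\<^bsub>G\<^esub> x"
      using x uv by simp
    also have "\<dots> = [(k * u)] \<cdot>\<^bsub>G\<^esub> x \<oplus> [(int (order G) * v)] \<cdot>\<^bsub>G\<^esub> x"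
      using x by (simp add: add.int_pow_mult)
    also have "[(int (order G) * v)] \<cdot>\<^bsub>G\<^esub> x = [v] \<cdot>\<^bsub>G\<^esub> ([int (order G)] \<cdot>\<^bsub>G\<^esub> x)"
      using x by (simp add: add.int_pow_pow)
    also have "\<dots> = \<zero>"
      by (simp add: ord)
    finally show ?thesis
      using x by simp
  qed
  show ?thesis
    by (rule bij_betwI[where g = "\<lambda>x. [u] \<cdot>\<^bsub>G\<^esub> x"])
      (auto simp: add.int_pow_pow inv mult.commute)
qed

end

section \<open>The energy bound from unsolvability\<close>

theorem theorem19:
  fixes G :: "('a, 'm) ring_scheme"
    and A :: "'a set" and \<beta> :: 'a and \<alpha> :: "nat \<Rightarrow> int"
    and n :: nat and \<delta> \<epsilon> :: real
  assumes "abelian_group G" and "finite (carrier G)"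
    and "n \<ge> 4"
    and "A \<subseteq> carrier G" and "real (card A) = \<delta> * real (order G)" and "\<delta> > 0"
    and "\<beta> \<in> carrier G"
    and "\<And>j. j \<in> {1..n} \<Longrightarrow> coprime (\<alpha> j) (int (order G))"
    and "\<not> (\<exists>x :: nat \<Rightarrow> 'a. (\<forall>j\<in>{1..n}. x j \<in> A) \<and>
              (\<Oplus>\<^bsub>G\<^esub>j\<in>{1..n}. [\<alpha> j] \<cdot>\<^bsub>G\<^esub> x j) = \<beta>)"
    and "0 < \<epsilon>" and "\<epsilon> \<le> 1 / 8"
  shows "\<exists>l::nat. 0 < l \<and>
           real l \<le> (3 * ln (1 / \<delta>)) powr (1 / (real (n div 2) - 1)) + 1 \<and>
           E_norm_pow G l (balanced_fun G A) \<ge>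
             \<epsilon> ^ (2 * l) * \<delta> ^ (2 * l) * real (order G) ^ (l + 1)"
proof -
  interpret abelian_group G
    by fact
  let ?C = "carrier G" and ?N = "real (order G)" and ?E = "E_norm_pow G 2 (balanced_fun G A)"
  define P where "P j = (\<lambda>x. [\<alpha> j] \<cdot>\<^bsub>G\<^esub> x) ` A" for j
  note fin = \<open>finite ?C\<close> and A = \<open>A \<subseteq> ?C\<close> and cardA = \<open>real (card A) = \<delta> * ?N\<close>
  have N: "?N > 0"
    using fin by (auto simp: order_def card_gt_0_iff)
  have bij: "bij_betw (\<lambda>x. [\<alpha> j] \<cdot>\<^bsub>G\<^esub> x) ?C ?C" if "j \<in> {1..n}" for j
    using bij_betw_dilation[OF fin assms(8)[OF that]] .
  have PC: "P j \<subseteq> ?C" for j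
    using A by (auto simp: P_def)
  have cardP: "card (P j) = card A" if "j \<in> {1..n}" for j
    unfolding P_def using bij_betw_imp_inj_on[OF bij[OF that]] A
    by (meson card_image inj_on_subset)
  have EP: "E_norm_pow G 2 (balanced_fun G (P j)) = ?E" if "j \<in> {1..n}" for j
    unfolding P_def using E_norm_pow_image[OF bij[OF that] _ A] by (simp add: add.int_pow_distrib)
  have "card A > 0"
    using cardA N \<open>\<delta> > 0\<close> by (metis mult_pos_pos of_nat_0_less_iff)
  then obtain a where a: "a \<in> A"
    by (metis card.empty equals0I less_irrefl)

  \<comment> \<open>All variables from the fifth on are frozen at one element \<open>a\<close> of
    \<open>A\<close>, leaving a four-term equation with right-hand side
    \<open>\<beta> \<ominus> s\<close>. For \<open>n = 4\<close> the sum is empty and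
    \<open>s\<close> is zero.\<close>
  define s where "s = (\<Oplus>\<^bsub>G\<^esub>j\<in>{5..n}. [\<alpha> j] \<cdot>\<^bsub>G\<^esub> a)"
  have aC: "a \<in> ?C"
    using a A by blast
  have s: "s \<in> ?C"
    using aC by (auto simp: s_def intro!: finsum_closed)
  have b: "\<beta> \<ominus>\<^bsub>G\<^esub> s \<in> ?C"
    using \<open>\<beta> \<in> ?C\<close> s by simp
  have no_repr: False
    if p: "p1 \<in> P 1" "p2 \<in> P 2" "p3 \<in> P 3" "p4 \<in> P 4"
      and eq: "(p1 \<oplus>\<^bsub>G\<^esub> p2) \<oplus>\<^bsub>G\<^esub> (p3 \<oplus>\<^bsub>G\<^esub> p4) = \<beta> \<ominus>\<^bsub>G\<^esub> s" for p1 p2 p3 p4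
  proof -
    obtain x1 x2 x3 x4 where x: "x1 \<in> A" "x2 \<in> A" "x3 \<in> A" "x4 \<in> A"
      and px: "p1 = [\<alpha> 1] \<cdot>\<^bsub>G\<^esub> x1" "p2 = [\<alpha> 2] \<cdot>\<^bsub>G\<^esub> x2"
        "p3 = [\<alpha> 3] \<cdot>\<^bsub>G\<^esub> x3" "p4 = [\<alpha> 4] \<cdot>\<^bsub>G\<^esub> x4"
      using p by (auto simp: P_def)
    have pC: "p1 \<in> ?C" "p2 \<in> ?C" "p3 \<in> ?C" "p4 \<in> ?C"
      using p PC by blast+
    \<comment> \<open>The default value \<open>a\<close> makes the tail of the sum over
      \<open>X\<close> equal to \<open>s\<close>.\<close>
    define X where "X = (\<lambda>j::nat. a)(1 := x1, 2 := x2, 3 := x3, 4 := x4)"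
    have X: "\<forall>j\<in>{1..n}. X j \<in> A"
      using x a by (simp add: X_def)
    have XC: "[\<alpha> j] \<cdot>\<^bsub>G\<^esub> X j \<in> ?C" for j
      using x a A by (auto simp: X_def)
    have "{1..n} = insert 1 (insert 2 (insert 3 (insert 4 {5..n})))"
      using \<open>n \<ge> 4\<close> by auto
    then have "(\<Oplus>\<^bsub>G\<^esub>j\<in>{1..n}. [\<alpha> j] \<cdot>\<^bsub>G\<^esub> X j)
        = p1 \<oplus>\<^bsub>G\<^esub> (p2 \<oplus>\<^bsub>G\<^esub> (p3 \<oplus>\<^bsub>G\<^esub> (p4 \<oplus>\<^bsub>G\<^esub> (\<Oplus>\<^bsub>G\<^esub>j\<in>{5..n}. [\<alpha> j] \<cdot>\<^bsub>G\<^esub> X j))))"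
      using XC by (simp add: finsum_insert Pi_def) (simp add: X_def px)
    also have "(\<Oplus>\<^bsub>G\<^esub>j\<in>{5..n}. [\<alpha> j] \<cdot>\<^bsub>G\<^esub> X j) = s"
      unfolding s_def by (rule finsum_cong') (use aC in \<open>auto simp: X_def\<close>)
    also have "p1 \<oplus>\<^bsub>G\<^esub> (p2 \<oplus>\<^bsub>G\<^esub> (p3 \<oplus>\<^bsub>G\<^esub> (p4 \<oplus>\<^bsub>G\<^esub> s))) = (\<beta> \<ominus>\<^bsub>G\<^esub> s) \<oplus>\<^bsub>G\<^esub> s"
      using pC s by (simp add: a_assoc flip: eq)
    also have "\<dots> = \<beta>"
      using s \<open>\<beta> \<in> ?C\<close> by (simp add: minus_eq a_assoc l_neg)
    finally show False
      using X assms(9) by blast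
  qed

  have "\<delta> \<le> 1 / 2"
  proof (rule ccontr)
    assume "\<not> \<delta> \<le> 1 / 2"
    then have "?N < 2 * (\<delta> * ?N)"
      using N by simp
    then have gt: "card (P 1) + card (P 2) > order G"
      using cardA cardP \<open>n \<ge> 4\<close> by simp
    \<comment> \<open>Any choice works here: the first two dilates already represent every element,
      in particular the difference that is left.\<close>
    obtain p3 p4 where p34: "p3 \<in> P 3" "p4 \<in> P 4"
      using a by (auto simp: P_def)
    then have c: "p3 \<oplus>\<^bsub>G\<^esub> p4 \<in> ?C"
      using PC by blast
    with b have "(\<beta> \<ominus>\<^bsub>G\<^esub> s) \<ominus>\<^bsub>G\<^esub> (p3 \<oplus>\<^bsub>G\<^esub> p4) \<in> ?C"
      by simp
    then obtain p1 p2 where p12: "p1 \<in> P 1" "p2 \<in> P 2"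
      and "p1 \<oplus>\<^bsub>G\<^esub> p2 = (\<beta> \<ominus>\<^bsub>G\<^esub> s) \<ominus>\<^bsub>G\<^esub> (p3 \<oplus>\<^bsub>G\<^esub> p4)"
      using add_represents_if_card_gt[OF fin PC PC gt] by metis
    then have "(p1 \<oplus>\<^bsub>G\<^esub> p2) \<oplus>\<^bsub>G\<^esub> (p3 \<oplus>\<^bsub>G\<^esub> p4) = \<beta> \<ominus>\<^bsub>G\<^esub> s"
      using b c by (simp add: minus_eq[of _ "p3 \<oplus>\<^bsub>G\<^esub> p4"] a_assoc l_neg del: minus_add)
    then show False
      using no_repr p12 p34 by blast
  qed
  \<comment> \<open>Follows from exp(1/3) \<le> 1 + 1/3 + 1/9 < 2. With \<delta> \<le> 1/2 the base
    of the power is at least 1, and its exponent is nonnegative as \<open>n div 2\<close> is at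
    least 2.\<close>
  have "1 \<le> 3 * ln (2::real)"
    using ln_ge_iff[of 2 "1/3::real"] exp_bound[of "1/3"] by (simp add: power2_eq_square)
  also have "\<dots> \<le> 3 * ln (1 / \<delta>)"
    using \<open>\<delta> > 0\<close> \<open>\<delta> \<le> 1 / 2\<close> by (simp add: field_simps)
  finally have "(3 * ln (1 / \<delta>)) powr (1 / (real (n div 2) - 1)) \<ge> 1"
    using \<open>n \<ge> 4\<close> by (intro ge_one_powr_ge_zero) auto
  moreover have "?E \<ge> \<epsilon> ^ 4 * \<delta> ^ 4 * ?N ^ 3"
  proof (rule ccontr)
    assume "\<not> ?thesis"
    then have "?E < \<epsilon> ^ 4 * \<delta> ^ 4 * ?N ^ 3"
      by simp
    also have "\<dots> \<le> (1 / 8) ^ 4 * \<delta> ^ 4 * ?N ^ 3"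
      using assms(10,11) N \<open>\<delta> > 0\<close> by (intro mult_right_mono power_mono) auto
    \<comment> \<open>Regrouped so that the square of \<open>\<delta>\<^sup>2 * ?N\<close>, the
      absolute value of the convolution off the sumset, cancels against the second-moment
      bound.\<close>
    also have "\<dots> = (1 / 8) ^ 4 * ?N * (\<delta>\<^sup>2 * ?N)\<^sup>2"
      by (simp add: power_mult_distrib power3_eq_cube power2_eq_square power4_eq_xxxx)
    finally have small: "?E < (1 / 8) ^ 4 * ?N * (\<delta>\<^sup>2 * ?N)\<^sup>2" .
    \<comment> \<open>Both dilates have energy \<open>?E\<close>, so the average in the
      second-moment bound is \<open>?E\<close> itself, and the complement of the sumset has fewer
      than \<open>?N / 4096\<close> elements.\<close>
    have large: "2 * card (P i <+>\<^bsub>G\<^esub> P j) > order G" if ij: "i \<in> {1..n}" "j \<in> {1..n}" for i j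
    proof -
      have "real (card (?C - (P i <+>\<^bsub>G\<^esub> P j))) * (\<delta>\<^sup>2 * ?N)\<^sup>2 \<le> ?E"
        using card_compl_sumset_le[OF fin PC PC, of i j] ij N
        by (simp add: EP cardP cardA power2_eq_square mult_ac)
      also note small
      finally have "real (card (?C - (P i <+>\<^bsub>G\<^esub> P j))) < (1 / 8) ^ 4 * ?N"
        using N \<open>\<delta> > 0\<close> by simp
      moreover have "card (?C - (P i <+>\<^bsub>G\<^esub> P j)) = order G - card (P i <+>\<^bsub>G\<^esub> P j)"
        unfolding order_def by (intro card_Diff_subset finite_subset[OF _ fin] set_add_closed PC)
      ultimately show ?thesis
        \<comment> \<open>The case distinction takes care of truncated subtraction on the
          naturals.\<close>
        using N by (cases "card (P i <+>\<^bsub>G\<^esub> P j) \<le> order G")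
          (auto simp: of_nat_diff power4_eq_xxxx)
    qed
    have "card (P 1 <+>\<^bsub>G\<^esub> P 2) + card (P 3 <+>\<^bsub>G\<^esub> P 4) > order G"
      using large[of 1 2] large[of 3 4] \<open>n \<ge> 4\<close> by simp
    then obtain u v where "u \<in> P 1 <+>\<^bsub>G\<^esub> P 2" "v \<in> P 3 <+>\<^bsub>G\<^esub> P 4" "u \<oplus>\<^bsub>G\<^esub> v = \<beta> \<ominus>\<^bsub>G\<^esub> s"
      using add_represents_if_card_gt[OF fin set_add_closed[OF PC PC] set_add_closed[OF PC PC] _ b]
      by metis
    then show False
      unfolding set_add_def' using no_repr by blast
  qed
  ultimately show ?thesis
    \<comment> \<open>At \<open>l = 2\<close> the exponents \<open>2 * l\<close> and
      \<open>l + 1\<close> become the 4 and 3 of the energy bound.\<close>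
    by (intro exI[of _ 2]) (simp add: numeral_eq_Suc)
qed

end
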